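(* Let $D,n\ge 3$ be integers, let $x$ be a vertex of the Hamming graph $H(D,n)$, and let $A$ be the adjacency matrix of the full bipartite graph $H(D,n)_f(x)$ of $H(D,n)$ with respect to $x$. Then $A$ is diagonalizable (over $\mathbb{R}$), and its set of eigenvalues is exactly $\{\theta_i \mid 0\le i\le 2D\}$, where $$\theta_i=\sqrt{n-1}\,(D-i).$$
   Context: Hamming graph: let $S$ be a set with $n$ elements. $H(D,n)$ has vertex set $X=S^D$, and two vertices are adjacent iff they differ in precisely one coordinate. $\partial$ denotes path-length distance in $H(D,n)$ (the Hamming distance). Full bipartite graph: given a connected graph with vertex set $X$, edge set $\mathcal{E}$, distance $\partial$, and a vertex $x$, its full bipartite graph with respect to $x$ is the graph $(X,\mathcal{E}_f)$ with $\mathcal{E}_f=\mathcal{E}\setminus\{yz \mid \partial(x,y)=\partial(x,z)\}$. The adjacency matrix is the usual real $0/1$ matrix with rows and columns indexed by $X$. *)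

theory Defs
  imports "HOL-Analysis.Analysis"
begin

(* A finite simple graph is given by its set of edges, each edge being a two-element
   set; its vertex set is the whole type 'v. *)

definition hamming_edges :: "('s::finite ^ 'd) set set" where
  "hamming_edges = {{y, z} | y z. card {i. y $ i \<noteq> z $ i} = 1}"

(* The least length of a walk from y to z. If there is no such walk, the value is
   unspecified; the notion is meant for connected graphs. *)
definition graph_dist :: "'v set set \<Rightarrow> 'v \<Rightarrow> 'v \<Rightarrow> nat" where
  "graph_dist E y z = (LEAST k. (y, z) \<in> {(u, v). {u, v} \<in> E} ^^ k)"

definition full_bipartite_edges :: "'v set set \<Rightarrow> 'v \<Rightarrow> 'v set set" where
  "full_bipartite_edges E x = E - {{y, z} | y z. graph_dist E x y = graph_dist E x z}"

definition adjacency_matrix :: "'v set set \<Rightarrow> real ^ 'v ^ 'v" where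
  "adjacency_matrix E = (\<chi> y z. if {y, z} \<in> E then 1 else 0)"

definition is_eigenvalue :: "real ^ 'v ^ 'v \<Rightarrow> real \<Rightarrow> bool" where
  "is_eigenvalue A c \<longleftrightarrow> (\<exists>v. v \<noteq> 0 \<and> A *v v = c *s v)"

definition diagonal_matrix :: "real ^ 'v ^ 'v \<Rightarrow> bool" where
  "diagonal_matrix B \<longleftrightarrow> (\<forall>i j. i \<noteq> j \<longrightarrow> B $ i $ j = 0)"

definition diagonalizable :: "real ^ 'v ^ 'v \<Rightarrow> bool" where
  "diagonalizable A \<longleftrightarrow>
     (\<exists>(P :: real ^ 'v ^ 'v) (B :: real ^ 'v ^ 'v). invertible P \<and>
        diagonal_matrix B \<and> A = P ** B ** matrix_inv P)"

end

theory Submission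
  imports Defs
begin

text \<open>
  An edge of the full bipartite graph changes a single coordinate \<open>i\<close>, and it survives the
  deletion exactly if the distance to \<open>x\<close> changes, that is, if exactly one of its two endpoints
  agrees with \<open>x\<close> at \<open>i\<close>.  The graph is therefore the Cartesian product, over all coordinates
  \<open>i\<close>, of the stars \<open>K\<^bsub>1,n-1\<^esub>\<close> on \<open>S\<close> with centre \<open>x $ i\<close>, and its adjacency matrix
  is the Kronecker sum of the adjacency matrices of these stars
  (\<open>adjacency_full_bipartite_hamming\<close>).

  A star has an explicit eigenbasis, with eigenvalues \<open>s\<close>, \<open>-s\<close> and \<open>0\<close> for
  \<open>s = sqrt (n - 1)\<close>; all three occur because \<open>n \<ge> 3\<close> (\<open>star_matrix_diagonalization\<close>).
  The tensor product of such eigenbases is an eigenbasis of the Kronecker sum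
  (\<open>kronecker_sum_intertwine\<close>), and the eigenvalue of a tensor product of eigenvectors is the
  sum of their eigenvalues.  The spectrum thus consists of \<open>s\<close> times all sums of \<open>D\<close>
  numbers from \<open>{-1, 0, 1}\<close>, and these sums are the integers from \<open>-D\<close> to \<open>D\<close>
  (\<open>sums_of_signs\<close>).
\<close>

section \<open>Matrices similar to a diagonal matrix\<close>

definition diag_matrix :: "('v \<Rightarrow> real) \<Rightarrow> real ^ 'v ^ 'v" where
  "diag_matrix d = (\<chi> i j. if i = j then d i else 0)"

lemma diag_matrix_mult_vec: "diag_matrix d *v w = (\<chi> i. d i * w $ i)"
  by (simp add: diag_matrix_def matrix_vector_mult_def vec_eq_iff if_distrib if_distribR
      cong: if_cong)

lemma mult_diag_matrix: "Q ** diag_matrix d = (\<chi> i j. Q $ i $ j * d j)"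
  by (simp add: diag_matrix_def matrix_matrix_mult_def vec_eq_iff if_distrib if_distribR
      cong: if_cong)

lemma diagonalizable_if_intertwined:
  fixes A P :: "real ^ 'v ^ 'v"
  assumes "invertible P" and "A ** P = P ** diag_matrix d"
  shows "diagonalizable A"
proof -
  have "\<exists>P'. P ** P' = mat 1 \<and> P' ** P = mat 1"
    using assms(1) by (simp add: invertible_def)
  then have "P ** matrix_inv P = mat 1"
    unfolding matrix_inv_def by (rule someI2_ex) simp
  then have "A = P ** diag_matrix d ** matrix_inv P"
    by (metis assms(2) matrix_mul_assoc matrix_mul_rid)
  moreover have "diagonal_matrix (diag_matrix d)"
    by (simp add: diagonal_matrix_def diag_matrix_def)
  ultimately show ?thesis
    using assms(1) by (auto simp: diagonalizable_def)
qed

text \<open>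
  The columns of \<open>P\<close> are eigenvectors for the values of \<open>d\<close>. Conversely, pulling an eigenvector
  back along \<open>P\<close> gives an eigenvector of the diagonal matrix, and any of its nonzero entries
  identifies the eigenvalue.
\<close>
lemma eigenvalues_if_intertwined:
  fixes A P :: "real ^ 'v::finite ^ 'v"
  assumes "invertible P" and AP: "A ** P = P ** diag_matrix d"
  shows "{c. is_eigenvalue A c} = range d"
proof -
  obtain P' where P': "P ** P' = mat 1" "P' ** P = mat 1"
    using assms(1) by (auto simp: invertible_def)
  have AP_vec: "A *v (P *v w) = P *v (diag_matrix d *v w)" for w
    by (simp add: matrix_vector_mul_assoc AP)
  have P_inj: "u = w" if "P *v u = P *v w" for u w
    using that P'(2) by (metis matrix_vector_mul_assoc matrix_vector_mul_lid)
  have "is_eigenvalue A (d i)" for i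
  proof -
    have "diag_matrix d *v axis i 1 = d i *s axis i 1"
      by (simp add: diag_matrix_mult_vec vec_eq_iff axis_def)
    then have "A *v (P *v axis i 1) = d i *s (P *v axis i 1)"
      by (simp add: AP_vec vector_scalar_commute)
    moreover have "P *v axis i 1 \<noteq> 0"
      using P_inj[of "axis i 1" 0] by (auto simp: axis_eq_0_iff)
    ultimately show ?thesis
      by (auto simp: is_eigenvalue_def)
  qed
  moreover have "c \<in> range d" if "is_eigenvalue A c" for c
  proof -
    obtain v where "v \<noteq> 0" and v: "A *v v = c *s v"
      using \<open>is_eigenvalue A c\<close> by (auto simp: is_eigenvalue_def)
    define w where "w = P' *v v"
    have "v = P *v w"
      by (simp add: w_def matrix_vector_mul_assoc P'(1))
    then have "P *v (diag_matrix d *v w) = P *v (c *s w)"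
      using v by (simp add: AP_vec vector_scalar_commute)
    then have "diag_matrix d *v w = c *s w"
      by (rule P_inj)
    then have dw: "d i * w $ i = c * w $ i" for i
      by (simp add: diag_matrix_mult_vec vec_eq_iff)
    have "w \<noteq> 0"
      using \<open>v \<noteq> 0\<close> \<open>v = P *v w\<close> by auto
    then obtain i where "w $ i \<noteq> 0"
      by (auto simp: vec_eq_iff)
    with dw[of i] show ?thesis
      by auto
  qed
  ultimately show ?thesis
    by auto
qed

section \<open>Tensor products and Kronecker sums\<close>

text \<open>
  The Kronecker product of the family \<open>M\<close>, with rows and columns indexed by vectors.
\<close>
definition tensor :: "('d::finite \<Rightarrow> real ^ 's ^ 's) \<Rightarrow> real ^ ('s ^ 'd) ^ ('s ^ 'd)" where
  "tensor M = (\<chi> y z. \<Prod>i\<in>UNIV. M i $ (y $ i) $ (z $ i))"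

text \<open>
  Written through \<open>tensor\<close>, so that products with a tensor product reduce to the factors.
\<close>
definition kronecker_sum ::
  "('d::finite \<Rightarrow> real ^ 's ^ 's) \<Rightarrow> real ^ ('s ^ 'd) ^ ('s ^ 'd)" where
  "kronecker_sum B = (\<Sum>i\<in>UNIV. tensor ((\<lambda>_. mat 1)(i := B i)))"

lemma prod_sum_vec:
  fixes f :: "'d::finite \<Rightarrow> 's::finite \<Rightarrow> real"
  shows "(\<Prod>i\<in>UNIV. \<Sum>a\<in>UNIV. f i a) = (\<Sum>w\<in>UNIV. \<Prod>i\<in>UNIV. f i (w $ i))"
proof -
  have "(\<Prod>i\<in>UNIV. \<Sum>a\<in>UNIV. f i a) = (\<Sum>g\<in>UNIV. \<Prod>i\<in>UNIV. f i (g i))"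
    by (subst prod_sum_PiE) auto
  also have "\<dots> = (\<Sum>w\<in>UNIV. \<Prod>i\<in>UNIV. f i (w $ i))"
    by (rule sum.reindex_bij_witness[where i = vec_nth and j = vec_lambda]) auto
  finally show ?thesis .
qed

text \<open>
  The mixed-product property: an entry of the left-hand side is a sum over all intermediate
  vectors of a product over the coordinates, which distributivity turns into a product of sums.
\<close>
lemma tensor_mult:
  fixes M N :: "'d::finite \<Rightarrow> real ^ 's::finite ^ 's"
  shows "tensor M ** tensor N = tensor (\<lambda>i. M i ** N i)"
  by (simp add: tensor_def matrix_matrix_mult_def vec_eq_iff prod_sum_vec prod.distrib)

lemma tensor_mat_1: "tensor (\<lambda>_::'d::finite. mat 1 :: real ^ 's ^ 's) = mat 1"
  by (auto simp: tensor_def mat_def vec_eq_iff)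

lemma invertible_tensor:
  fixes Q :: "'d::finite \<Rightarrow> real ^ 's::finite ^ 's"
  assumes "\<And>i. invertible (Q i)"
  shows "invertible (tensor Q)"
proof -
  obtain R where "\<And>i. Q i ** R i = mat 1 \<and> R i ** Q i = mat 1"
    using assms unfolding invertible_def by metis
  then show ?thesis
    unfolding invertible_def by (intro exI[of _ "tensor R"]) (simp add: tensor_mult tensor_mat_1)
qed

lemma matrix_mult_sum_left:
  fixes M :: "real ^ 'n::finite ^ 'm::finite"
  shows "(\<Sum>i\<in>I. F i) ** M = (\<Sum>i\<in>I. F i ** M)"
  by (simp add: matrix_matrix_mult_def vec_eq_iff sum_distrib_right sum.swap[of _ I])

lemma matrix_mult_sum_right:
  fixes M :: "real ^ 'n::finite ^ 'm::finite"
  shows "M ** (\<Sum>i\<in>I. F i) = (\<Sum>i\<in>I. M ** F i)"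
  by (simp add: matrix_matrix_mult_def vec_eq_iff sum_distrib_left sum.swap[of _ I])

text \<open>
  Multiplying the summand for \<open>i\<close> by \<open>tensor Q\<close> on either side changes only its factor at
  \<open>i\<close>, where the assumption applies; the other factors are \<open>Q j\<close> on both sides.
\<close>
lemma kronecker_sum_intertwine:
  fixes B C Q :: "'d::finite \<Rightarrow> real ^ 's::finite ^ 's"
  assumes "\<And>i. B i ** Q i = Q i ** C i"
  shows "kronecker_sum B ** tensor Q = tensor Q ** kronecker_sum C"
proof -
  have "tensor ((\<lambda>_. mat 1)(i := B i)) ** tensor Q
      = tensor Q ** tensor ((\<lambda>_. mat 1)(i := C i))" for i
    unfolding tensor_mult by (rule arg_cong[where f = tensor]) (auto simp: assms)
  then show ?thesis
    by (simp add: kronecker_sum_def matrix_mult_sum_left matrix_mult_sum_right)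
qed

lemma kronecker_sum_nth:
  fixes B :: "'d::finite \<Rightarrow> real ^ 's::finite ^ 's"
  shows "kronecker_sum B $ y $ z
    = (\<Sum>i\<in>UNIV. if \<forall>j. j \<noteq> i \<longrightarrow> y $ j = z $ j then B i $ (y $ i) $ (z $ i) else 0)"
proof -
  have "tensor ((\<lambda>_. mat 1)(i := B i)) $ y $ z
      = (if \<forall>j. j \<noteq> i \<longrightarrow> y $ j = z $ j then B i $ (y $ i) $ (z $ i) else 0)" for i
  proof -
    have "tensor ((\<lambda>_. mat 1)(i := B i)) $ y $ z
        = B i $ (y $ i) $ (z $ i) * (\<Prod>j\<in>UNIV - {i}. if y $ j = z $ j then 1 else 0)"
      by (simp add: tensor_def prod.remove[of UNIV i] mat_def)
    also have "(\<Prod>j\<in>UNIV - {i}. if y $ j = z $ j then 1 else 0 :: real)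
        = (if \<forall>j. j \<noteq> i \<longrightarrow> y $ j = z $ j then 1 else 0)"
      by auto
    finally show ?thesis
      by (simp only: if_distrib[where f = "(*) _"] mult_1_right mult_zero_right)
  qed
  then show ?thesis
    by (simp add: kronecker_sum_def)
qed

lemma kronecker_sum_diag_matrix:
  fixes l :: "'d::finite \<Rightarrow> 's::finite \<Rightarrow> real"
  shows "kronecker_sum (\<lambda>i. diag_matrix (l i)) = diag_matrix (\<lambda>z. \<Sum>i\<in>UNIV. l i (z $ i))"
proof -
  have "kronecker_sum (\<lambda>i. diag_matrix (l i)) $ y $ z
      = diag_matrix (\<lambda>z. \<Sum>i\<in>UNIV. l i (z $ i)) $ y $ z" for y z
  proof (cases "y = z")
    case True
    then show ?thesis
      by (simp add: kronecker_sum_nth diag_matrix_def)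
  next
    case False
    have "(if \<forall>j. j \<noteq> i \<longrightarrow> y $ j = z $ j then diag_matrix (l i) $ (y $ i) $ (z $ i) else 0) = 0"
      for i
      using False by (auto simp: diag_matrix_def vec_eq_iff)
    with False show ?thesis
      by (simp add: kronecker_sum_nth) (simp add: diag_matrix_def)
  qed
  then show ?thesis
    by (simp add: vec_eq_iff)
qed

section \<open>Star graphs\<close>

definition star_matrix :: "'s \<Rightarrow> real ^ 's ^ 's" where
  "star_matrix c = (\<chi> a b. if (a = c) \<noteq> (b = c) then 1 else 0)"

text \<open>
  Fix a leaf \<open>p\<close>. The vectors that are \<open>s\<close> or \<open>-s\<close> at the centre and \<open>1\<close> on the leaves
  belong to the eigenvalues \<open>s\<close> and \<open>-s\<close>, and for every other leaf \<open>b\<close> the vector that is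
  \<open>1\<close> at \<open>b\<close> and \<open>-1\<close> at \<open>p\<close> lies in the kernel. A leaf \<open>b\<close> of the last kind exists
  because there are at least three vertices, so \<open>0\<close> is an eigenvalue.
\<close>
lemma star_matrix_diagonalization:
  fixes c :: "'s::finite"
  assumes card: "CARD('s) \<ge> 3"
  shows "\<exists>(Q :: real ^ 's ^ 's) l. invertible Q \<and>
    star_matrix c ** Q = Q ** diag_matrix (\<lambda>b. sqrt (real CARD('s) - 1) * l b) \<and>
    range l = {-1, 0, 1}"
proof -
  define s where "s = sqrt (real CARD('s) - 1)"
  have s: "s * s = real CARD('s) - 1" "s \<noteq> 0"
    using card by (auto simp: s_def)
  have "card {c} \<le> 2"
    by simp
  then have "{c} \<noteq> UNIV"
    using card by fastforce
  then obtain p where p: "p \<noteq> c"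
    by auto
  have "card {c, p} \<le> 2"
    by (simp add: card_insert_if)
  then have "{c, p} \<noteq> UNIV"
    using card by fastforce
  then obtain q where q: "q \<noteq> c" "q \<noteq> p"
    by auto
  \<comment> \<open>The eigenvectors for \<open>s\<close> and \<open>-s\<close> are the columns \<open>c\<close> and \<open>p\<close>; the kernel vectors
    fill the remaining columns.\<close>
  define Q :: "real ^ 's ^ 's" where "Q = (\<chi> a b.
    if b = c then (if a = c then s else 1)
    else if b = p then (if a = c then - s else 1)
    else (if a = b then 1 else 0) - (if a = p then 1 else 0))"
  define l :: "'s \<Rightarrow> real" where "l b = (if b = c then 1 else if b = p then - 1 else 0)" for b
  have "invertible Q"
    unfolding invertible_left_inverse matrix_left_invertible_ker
  proof (intro allI impI)
    fix v assume "Q *v v = 0"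
    then have row: "(\<Sum>b\<in>UNIV. Q $ a $ b * v $ b) = 0" for a
      by (simp add: matrix_vector_mult_def vec_eq_iff)
    have split: "(\<Sum>b\<in>UNIV. f b) = f c + f p + (\<Sum>b\<in>UNIV - {c, p}. f b)" for f :: "'s \<Rightarrow> real"
      using p by (simp add: sum.subset_diff[of "{c, p}" UNIV])
    \<comment> \<open>Row \<open>c\<close> gives \<open>v $ p = v $ c\<close>, the rows of the other leaves express every entry
      through \<open>v $ c\<close>, and then row \<open>p\<close> is a positive multiple of \<open>v $ c\<close>.\<close>
    have "(\<Sum>b\<in>UNIV - {c, p}. Q $ c $ b * v $ b) = 0"
      using p by (intro sum.neutral) (auto simp: Q_def)
    then have "s * v $ c - s * v $ p = 0"
      using row[of c] p unfolding split by (simp add: Q_def)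
    then have vp: "v $ p = v $ c"
      using s by (simp add: right_diff_distrib[symmetric])
    have va: "v $ a = - 2 * v $ c" if "a \<noteq> c" "a \<noteq> p" for a
    proof -
      have "(\<Sum>b\<in>UNIV - {c, p}. Q $ a $ b * v $ b)
          = (\<Sum>b\<in>UNIV - {c, p}. if b = a then v $ b else 0)"
        using that by (intro sum.cong) (auto simp: Q_def)
      also have "\<dots> = v $ a"
        using that by simp
      finally show ?thesis
        using row[of a] that vp p unfolding split by (simp add: Q_def)
    qed
    have "(\<Sum>b\<in>UNIV - {c, p}. Q $ p $ b * v $ b) = (\<Sum>b\<in>UNIV - {c, p}. 2 * v $ c)"
    proof (rule sum.cong)
      fix b assume "b \<in> UNIV - {c, p}"
      then have "b \<noteq> c" "b \<noteq> p"
        by auto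
      then have "Q $ p $ b = - 1" "v $ b = - 2 * v $ c"
        using va by (simp_all add: Q_def)
      then show "Q $ p $ b * v $ b = 2 * v $ c"
        by simp
    qed simp
    also have "\<dots> = real (card (UNIV - {c, p})) * (2 * v $ c)"
      by simp
    finally have "(2 + 2 * real (card (UNIV - {c, p}))) * v $ c = 0"
      using row[of p] vp p unfolding split by (simp add: Q_def algebra_simps)
    then have "v $ c = 0"
      by (simp add: add_nonneg_eq_0_iff)
    then show "v = 0"
      using vp va by (metis mult_zero_right vec_eq_iff zero_index)
  qed
  moreover have "star_matrix c ** Q = Q ** diag_matrix (\<lambda>b. s * l b)"
  proof -
    have leaf: "(star_matrix c ** Q) $ a $ b = Q $ c $ b" if "a \<noteq> c" for a b
      using that by (simp add: matrix_matrix_mult_def star_matrix_def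
          if_distrib[of "\<lambda>u. u * w" for w] cong: if_cong)
    have centre: "(star_matrix c ** Q) $ c $ b = (\<Sum>k\<in>UNIV - {c}. Q $ k $ b)" for b
      by (simp add: matrix_matrix_mult_def star_matrix_def sum.remove[of UNIV c])
    have "real (card (UNIV - {c})) = s * s"
      using card by (simp add: s card_Diff_singleton of_nat_diff)
    then have "(\<Sum>k\<in>UNIV - {c}. Q $ k $ b) = Q $ c $ b * (s * l b)" for b
      using p by (simp add: Q_def l_def sum_subtractf)
    then show ?thesis
      using leaf centre p by (auto simp: mult_diag_matrix vec_eq_iff Q_def l_def)
  qed
  moreover have "range l = {-1, 0, 1}"
  proof
    show "{-1, 0, 1} \<subseteq> range l"
      using p q by (auto simp: l_def image_iff)
  qed (auto simp: l_def)
  ultimately show ?thesis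
    unfolding s_def by blast
qed

section \<open>The full bipartite graph as a Cartesian product of stars\<close>

lemma hamming_edge_iff: "{y, z} \<in> hamming_edges \<longleftrightarrow> card {i. y $ i \<noteq> z $ i} = 1"
proof -
  have "{i. z $ i \<noteq> y $ i} = {i. y $ i \<noteq> z $ i}"
    by auto
  then show ?thesis
    by (auto simp: hamming_edges_def doubleton_eq_iff)
qed

text \<open>
  A step changes the number of differing coordinates by at most one, and the bound is attained
  by correcting the differing coordinates one after the other.
\<close>
lemma graph_dist_hamming:
  fixes y z :: "'s::finite ^ 'd::finite"
  shows "graph_dist hamming_edges y z = card {i. y $ i \<noteq> z $ i}"
proof -
  define R where "R = {(u, v :: 's ^ 'd). {u, v} \<in> hamming_edges}"
  have R: "(u, v) \<in> R \<longleftrightarrow> card {i. u $ i \<noteq> v $ i} = 1" for u v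
    by (simp add: R_def hamming_edge_iff)
  have lower: "card {i. y $ i \<noteq> z $ i} \<le> k" if "(y, z) \<in> R ^^ k" for k z
    using that
  proof (induction k arbitrary: z)
    case (Suc k)
    then obtain u where u: "(y, u) \<in> R ^^ k" "(u, z) \<in> R"
      by auto
    have "card {i. y $ i \<noteq> z $ i} \<le> card ({i. y $ i \<noteq> u $ i} \<union> {i. u $ i \<noteq> z $ i})"
      by (rule card_mono) auto
    also have "\<dots> \<le> card {i. y $ i \<noteq> u $ i} + card {i. u $ i \<noteq> z $ i}"
      by (rule card_Un_le)
    finally show ?case
      using Suc.IH[OF u(1)] u(2) by (simp add: R)
  qed auto
  have upper: "(y, z) \<in> R ^^ k" if "card {i. y $ i \<noteq> z $ i} = k" for k z
    using that
  proof (induction k arbitrary: z)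
    case 0
    then show ?case
      by (simp add: vec_eq_iff)
  next
    case (Suc k)
    then have "{i. y $ i \<noteq> z $ i} \<noteq> {}"
      by force
    then obtain i where i: "y $ i \<noteq> z $ i"
      by auto
    define u where "u = (\<chi> j. if j = i then y $ i else z $ j)"
    have "{j. y $ j \<noteq> u $ j} = {j. y $ j \<noteq> z $ j} - {i}"
      by (auto simp: u_def)
    then have "(y, u) \<in> R ^^ k"
      using Suc i by (intro Suc.IH) simp
    moreover have "{j. u $ j \<noteq> z $ j} = {i}"
      using i by (auto simp: u_def)
    then have "(u, z) \<in> R"
      by (simp add: R)
    ultimately show ?case
      by auto
  qed
  have "(LEAST k. (y, z) \<in> R ^^ k) = card {i. y $ i \<noteq> z $ i}"
    by (rule Least_equality) (use lower upper in auto)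
  then show ?thesis
    by (simp add: graph_dist_def R_def)
qed

text \<open>
  Among two vertices that differ only at \<open>i\<close>, all coordinates other than \<open>i\<close> contribute equally
  to the distances from \<open>x\<close>, so only agreement with \<open>x\<close> at \<open>i\<close> can make them different.
\<close>
lemma full_bipartite_hamming_edge_iff:
  fixes x y z :: "'s::finite ^ 'd::finite"
  shows "{y, z} \<in> full_bipartite_edges hamming_edges x \<longleftrightarrow>
    (\<exists>i. (\<forall>j. j \<noteq> i \<longrightarrow> y $ j = z $ j) \<and> (y $ i = x $ i) \<noteq> (z $ i = x $ i))"
proof -
  let ?dist = "\<lambda>y. card {i. x $ i \<noteq> y $ i}"
  have edge: "{y, z} \<in> full_bipartite_edges hamming_edges x \<longleftrightarrow>
      card {i. y $ i \<noteq> z $ i} = 1 \<and> ?dist y \<noteq> ?dist z"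
    by (auto simp: full_bipartite_edges_def hamming_edge_iff graph_dist_hamming doubleton_eq_iff)
  have dist: "?dist y = ?dist z \<longleftrightarrow> (y $ i = x $ i) = (z $ i = x $ i)"
    if "\<And>j. j \<noteq> i \<Longrightarrow> y $ j = z $ j" for i
  proof -
    define T where "T = {j. j \<noteq> i \<and> x $ j \<noteq> y $ j}"
    have "{j. x $ j \<noteq> y $ j} = (if y $ i = x $ i then T else insert i T)"
      by (auto simp: T_def)
    moreover have "{j. x $ j \<noteq> z $ j} = (if z $ i = x $ i then T else insert i T)"
      using that by (auto simp: T_def) metis+
    moreover have "i \<notin> T"
      by (simp add: T_def)
    ultimately show ?thesis
      by simp
  qed
  show ?thesis
    unfolding edge
  proof
    assume *: "card {i. y $ i \<noteq> z $ i} = 1 \<and> ?dist y \<noteq> ?dist z"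
    then obtain i where "{i. y $ i \<noteq> z $ i} = {i}"
      by (auto simp: card_1_singleton_iff)
    then have "\<And>j. j \<noteq> i \<Longrightarrow> y $ j = z $ j"
      by auto
    with dist[of i] * show "\<exists>i. (\<forall>j. j \<noteq> i \<longrightarrow> y $ j = z $ j) \<and>
        (y $ i = x $ i) \<noteq> (z $ i = x $ i)"
      by blast
  next
    assume "\<exists>i. (\<forall>j. j \<noteq> i \<longrightarrow> y $ j = z $ j) \<and> (y $ i = x $ i) \<noteq> (z $ i = x $ i)"
    then obtain i where i: "\<And>j. j \<noteq> i \<Longrightarrow> y $ j = z $ j"
        "(y $ i = x $ i) \<noteq> (z $ i = x $ i)"
      by blast
    then have "{i. y $ i \<noteq> z $ i} = {i}"
      by auto
    with dist[of i] i show "card {i. y $ i \<noteq> z $ i} = 1 \<and> ?dist y \<noteq> ?dist z"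
      by simp
  qed
qed

text \<open>
  At most one coordinate contributes to an entry of the Kronecker sum, since star matrices have
  zero diagonal; hence the entries are again \<open>0\<close> or \<open>1\<close>.
\<close>
lemma adjacency_full_bipartite_hamming:
  fixes x :: "'s::finite ^ 'd::finite"
  shows "adjacency_matrix (full_bipartite_edges hamming_edges x)
    = kronecker_sum (\<lambda>i. star_matrix (x $ i))"
proof -
  have "kronecker_sum (\<lambda>i. star_matrix (x $ i)) $ y $ z
      = (if {y, z} \<in> full_bipartite_edges hamming_edges x then 1 else 0)" for y z
  proof -
    define K where
      "K i \<longleftrightarrow> (\<forall>j. j \<noteq> i \<longrightarrow> y $ j = z $ j) \<and> (y $ i = x $ i) \<noteq> (z $ i = x $ i)" for i
    have "kronecker_sum (\<lambda>i. star_matrix (x $ i)) $ y $ z = (\<Sum>i\<in>UNIV. if K i then 1 else 0)"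
      unfolding kronecker_sum_nth by (intro sum.cong) (auto simp: K_def star_matrix_def)
    also have "\<dots> = (if \<exists>i. K i then 1 else 0)"
    proof (cases "\<exists>i. K i")
      case True
      then obtain i where "K i" ..
      then have "K j \<longleftrightarrow> j = i" for j
        unfolding K_def by metis
      then show ?thesis
        by simp
    qed simp
    finally show ?thesis
      by (simp add: full_bipartite_hamming_edge_iff K_def)
  qed
  then show ?thesis
    by (simp add: adjacency_matrix_def vec_eq_iff)
qed

section \<open>The spectrum\<close>

text \<open>
  Each summand is \<open>1 - m i\<close> with \<open>m i \<le> 2\<close>, which bounds \<open>k\<close>. Conversely, lowering \<open>k\<close>
  of the summands from \<open>1\<close> to \<open>0\<close> realises \<open>CARD('d) - k\<close> up to \<open>k = CARD('d)\<close>; beyond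
  that, all are \<open>0\<close> and the excess is lowered to \<open>-1\<close>.
\<close>
lemma sums_of_signs:
  "{\<Sum>i\<in>UNIV. f i | f :: 'd::finite \<Rightarrow> real. \<forall>i. f i \<in> {-1, 0, 1}}
    = {real CARD('d) - real k | k. k \<le> 2 * CARD('d)}"
proof (intro equalityI subsetI)
  fix t assume "t \<in> {\<Sum>i\<in>UNIV. f i | f :: 'd \<Rightarrow> real. \<forall>i. f i \<in> {-1, 0, 1}}"
  then obtain f :: "'d \<Rightarrow> real" where t: "t = (\<Sum>i\<in>UNIV. f i)" and f: "\<And>i. f i \<in> {-1, 0, 1}"
    by blast
  have "\<exists>m. m \<le> 2 \<and> f i = 1 - real m" for i
    using f[of i] by (auto intro: exI[of _ 0] exI[of _ 1] exI[of _ 2])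
  then obtain m :: "'d \<Rightarrow> nat" where m: "\<And>i. m i \<le> 2" "\<And>i. f i = 1 - real (m i)"
    by metis
  have "t = real CARD('d) - real (\<Sum>i\<in>UNIV. m i)"
    by (simp add: t m(2) sum_subtractf)
  moreover have "(\<Sum>i\<in>UNIV. m i) \<le> 2 * CARD('d)"
    using sum_bounded_above[of UNIV m 2] m(1) by simp
  ultimately show "t \<in> {real CARD('d) - real k | k. k \<le> 2 * CARD('d)}"
    by blast
next
  fix t assume "t \<in> {real CARD('d) - real k | k. k \<le> 2 * CARD('d)}"
  then obtain k where t: "t = real CARD('d) - real k" and k: "k \<le> 2 * CARD('d)"
    by blast
  have card: "(\<Sum>i\<in>UNIV. indicat_real T i) = real (card T)" for T :: "'d set"
    by (simp add: indicator_def of_bool_def sum.If_cases)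
  have "\<exists>f :: 'd \<Rightarrow> real. (\<forall>i. f i \<in> {-1, 0, 1}) \<and> (\<Sum>i\<in>UNIV. f i) = t"
  proof (cases "k \<le> CARD('d)")
    case True
    then obtain T :: "'d set" where T: "card T = k"
      by (meson obtain_subset_with_card_n)
    have "(\<Sum>i\<in>UNIV. 1 - indicat_real T i) = t"
      by (simp add: t T card sum_subtractf)
    then show ?thesis
      by (intro exI[of _ "\<lambda>i. 1 - indicat_real T i"]) (auto simp: indicator_def)
  next
    case False
    then obtain T :: "'d set" where T: "card T = k - CARD('d)"
      using k by (metis add_le_imp_le_left le_diff_conv mult_2 obtain_subset_with_card_n)
    have "(\<Sum>i\<in>UNIV. - indicat_real T i) = t"
      using False by (simp add: t T card sum_negf of_nat_diff)
    then show ?thesis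
      by (intro exI[of _ "\<lambda>i. - indicat_real T i"]) (auto simp: indicator_def)
  qed
  then show "t \<in> {\<Sum>i\<in>UNIV. f i | f :: 'd \<Rightarrow> real. \<forall>i. f i \<in> {-1, 0, 1}}"
    by blast
qed

theorem theorem6p3:
  fixes D n :: nat
    and x :: "'s::finite ^ 'd::finite"
    and A :: "real ^ ('s ^ 'd) ^ ('s ^ 'd)"
  assumes "CARD('d) = D" and "CARD('s) = n"
    and "D \<ge> 3" and "n \<ge> 3"
    and "A = adjacency_matrix (full_bipartite_edges hamming_edges x)"
  shows "diagonalizable A \<and>
    {c. is_eigenvalue A c} = {sqrt (real n - 1) * (real D - real i) | i. i \<le> 2 * D}"
proof -
  define s where "s = sqrt (real n - 1)"
  have "\<exists>(Q :: real ^ 's ^ 's) l. invertible Q \<and>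
      star_matrix (x $ i) ** Q = Q ** diag_matrix (\<lambda>b. s * l b) \<and> range l = {-1, 0, 1}" for i
    using star_matrix_diagonalization[of "x $ i"] assms by (simp add: s_def)
  then obtain Q :: "'d \<Rightarrow> real ^ 's ^ 's" and l :: "'d \<Rightarrow> 's \<Rightarrow> real" where
      Q: "\<And>i. invertible (Q i)"
        "\<And>i. star_matrix (x $ i) ** Q i = Q i ** diag_matrix (\<lambda>b. s * l i b)"
      and l: "\<And>i. range (l i) = {-1, 0, 1}"
    by metis
  have P: "invertible (tensor Q)"
    using Q(1) by (rule invertible_tensor)
  have AP: "A ** tensor Q = tensor Q ** diag_matrix (\<lambda>z. \<Sum>i\<in>UNIV. s * l i (z $ i))"
    using kronecker_sum_intertwine[OF Q(2)] assms
    by (simp add: adjacency_full_bipartite_hamming kronecker_sum_diag_matrix)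
  \<comment> \<open>The coordinates of \<open>z\<close> are independent, so the signs can be prescribed separately.\<close>
  have "range (\<lambda>z :: 's ^ 'd. \<Sum>i\<in>UNIV. l i (z $ i))
      = {\<Sum>i\<in>UNIV. f i | f :: 'd \<Rightarrow> real. \<forall>i. f i \<in> {-1, 0, 1}}"
  proof (intro equalityI subsetI)
    fix t assume "t \<in> {\<Sum>i\<in>UNIV. f i | f :: 'd \<Rightarrow> real. \<forall>i. f i \<in> {-1, 0, 1}}"
    then obtain f :: "'d \<Rightarrow> real" where t: "t = (\<Sum>i\<in>UNIV. f i)" and "\<And>i. f i \<in> range (l i)"
      unfolding l by blast
    then have "\<forall>i. \<exists>a. f i = l i a"
      by blast
    then obtain z where "\<And>i. f i = l i (z i)"
      by metis
    then have "t = (\<Sum>i\<in>UNIV. l i ((\<chi> i. z i) $ i))"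
      by (simp add: t)
    then show "t \<in> range (\<lambda>z :: 's ^ 'd. \<Sum>i\<in>UNIV. l i (z $ i))"
      by blast
  next
    fix t assume "t \<in> range (\<lambda>z :: 's ^ 'd. \<Sum>i\<in>UNIV. l i (z $ i))"
    then obtain z :: "'s ^ 'd" where "t = (\<Sum>i\<in>UNIV. l i (z $ i))"
      by blast
    moreover have "\<forall>i. l i (z $ i) \<in> {-1, 0, 1}"
      using l by blast
    ultimately show "t \<in> {\<Sum>i\<in>UNIV. f i | f :: 'd \<Rightarrow> real. \<forall>i. f i \<in> {-1, 0, 1}}"
      by blast
  qed
  then have spectrum: "range (\<lambda>z :: 's ^ 'd. \<Sum>i\<in>UNIV. l i (z $ i))
      = {real D - real k | k. k \<le> 2 * D}"
    by (simp only: sums_of_signs assms(1))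
  have "{c. is_eigenvalue A c} = range (\<lambda>z :: 's ^ 'd. \<Sum>i\<in>UNIV. s * l i (z $ i))"
    by (rule eigenvalues_if_intertwined[OF P AP])
  also have "\<dots> = (*) s ` range (\<lambda>z :: 's ^ 'd. \<Sum>i\<in>UNIV. l i (z $ i))"
    by (simp add: image_image sum_distrib_left)
  also have "\<dots> = {s * (real D - real i) | i. i \<le> 2 * D}"
    unfolding spectrum by blast
  finally show ?thesis
    using diagonalizable_if_intertwined[OF P AP] by (simp add: s_def)
qed

end
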